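(* Let $f\colon\mathbb{R}^n\to\mathbb{R}$ and $c\colon\mathbb{R}^n\to\mathbb{R}^m$ be continuously differentiable, and let $\{x^k,y^k,z^k\}$ be a sequence of iterates generated by the regularized interior point algorithm described in the context with termination tolerance $\varepsilon=0$. Let $x^\ast$ be a limit point of $\{x^k\}$ that is feasible for the problem (P) of minimizing $f(x)$ subject to $c(x)=0$, $x\ge0$ (that is, $x^\ast\ge0$ and $c(x^\ast)=0$), and let $\{x^k\}_{k\in K}$, $K\subset\mathbb{N}$ infinite, be a subsequence converging to $x^\ast$. Then: (i) $x^\ast$ is an AKKT stationary point for (P). (ii) If $\{y^k,z^k\}_{k\in K}$ remain bounded, then $x^\ast$ is KKT stationary for (P).
   Context: Notation: $\|\cdot\|$ is the Euclidean norm; $\nabla c(x)\in\mathbb{R}^{m\times n}$ is the Jacobian of $c$; vector inequalities and $\min$ of vectors are componentwise. The algorithm is understood to generate an infinite sequence when limit points are considered. Problem (P): minimize $f(x)$ over $x\in\mathbb{R}^n$ subject to $c(x)=0$, $x\ge 0$. $\varepsilon$-KKT stationarity for (P) ($\varepsilon\ge0$): $x^\ast$ is $\varepsilon$-KKT stationary, with multipliers $y^\ast\in\mathbb{R}^m$, $z^\ast\in\mathbb{R}^n$, if $\|\nabla f(x^\ast)+\nabla c(x^\ast)^\top y^\ast+z^\ast\|\le\varepsilon$, $\|c(x^\ast)\|\le\varepsilon$, $x^\ast\ge-\varepsilon$, $z^\ast\le\varepsilon$, $\min\{x^\ast,-z^\ast\}\le\varepsilon$. The point $x^\ast$ is KKT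 stationary if such multipliers exist with $\varepsilon=0$. For a problem with equality constraints only, minimize $F(w)$ subject to $G(w)=0$, $w$ is $\varepsilon$-KKT stationary with multiplier $y$ if $w$ lies in the domain of $F$, $\|\nabla F(w)+\nabla G(w)^\top y\|\le\varepsilon$ and $\|G(w)\|\le\varepsilon$. AKKT stationarity for (P): a feasible point $x^\ast$ is AKKT (asymptotically KKT) stationary if there exist sequences $\{\xi^j\},\{\zeta^j\}\subset\mathbb{R}^n$ and $\{\upsilon^j\}\subset\mathbb{R}^m$ such that $\xi^j\to x^\ast$, $\nabla f(\xi^j)+\nabla c(\xi^j)^\top \upsilon^j+\zeta^j\to0$ and $\min\{\xi^j,-\zeta^j\}\to0$. Barrier: for $i=1,\dots,n$, $b_i\colon\mathbb{R}\to\mathbb{R}\cup\{\infty\}$ has domain (set where it is finite) $(0,\infty)$, is continuously differentiable there, satisfies $b_i(t)\to\infty$ as $t\to0^+$ and $b_i'\le0$ on $(0,\infty)$. Put $b(x)=\sum_{i=1}^n b_i(x_i)$, with domain $(0,\infty)^n$. Regularized barrier subproblem $(S_k)$, for given $\rho_k,\mu_k>0$ and $\hat y^k\in\mathbb{R}^m$: $$\text{minimize over }(x,\lambda)\in\mathbb{R}^n\times\mathbb{R}^m:\ f(x)+\tfrac{\rho_k}{2}\|\lambda\|^2+\mu_k b(x)\quad\text{subject to } c(x)+\rho_k(\hat y^k-\lambda)=0 .$$ Algorithm. Data: $\epsilon_0,\rho_0,\mu_0>0$; $\kappa_\rho,\kappa_\mu,\kappa_\epsilon\in(0,1)$; $\theta_\rho,\theta_\mu\in[0,1)$;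 a nonempty bounded set $Y\subset\mathbb{R}^m$; a termination tolerance $\varepsilon\ge0$. For $k=0,1,2,\dots$: 1. Select $\hat y^k\in Y$. 2. Find an $\epsilon_k$-KKT stationary point $(x^k,\lambda^k)$ for $(S_k)$, with multiplier $y^k\in\mathbb{R}^m$. 3. Set $z^k=\mu_k\nabla b(x^k)$. 4. If $x^k$ is $\varepsilon$-KKT stationary for (P) with multipliers $y^k,z^k$, stop and return $(x^k,y^k,z^k)$. 5. Set $C^k=\|c(x^k)\|$ and $V^k=\|\min\{x^k,-z^k\}\|$. 6. If $k=0$ or $C^k\le\max\{\varepsilon,\theta_\rho C^{k-1}\}$, set $\rho_{k+1}=\rho_k$; otherwise select $\rho_{k+1}\in(0,\kappa_\rho\rho_k]$. 7. If $k=0$ or $V^k\le\max\{\varepsilon,\theta_\mu V^{k-1}\}$, set $\mu_{k+1}=\mu_k$; otherwise select $\mu_{k+1}\in(0,\kappa_\mu\mu_k]$. 8. Set $\epsilon_{k+1}=\max\{\varepsilon,\kappa_\epsilon\epsilon_k\}$. Standing assumption: the subproblems $(S_k)$ are well-posed for all $\mu_k\le\mu_0$, $\rho_k\le\rho_0$, $\hat y^k\in Y$, so that step 2 can always be carried out. *)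

theory Defs
  imports "HOL-Analysis.Analysis"
begin

definition continuously_differentiable ::
  "('a::euclidean_space \<Rightarrow> 'b::euclidean_space) \<Rightarrow> bool" where
  "continuously_differentiable f \<longleftrightarrow>
     (\<exists>D :: 'a \<Rightarrow> ('a \<Rightarrow>\<^sub>L 'b).
        (\<forall>x. (f has_derivative blinfun_apply (D x)) (at x)) \<and> continuous_on UNIV D)"

definition grad :: "('a::euclidean_space \<Rightarrow> real) \<Rightarrow> 'a \<Rightarrow> 'a" where
  "grad f x = (THE D. GDERIV f x :> D)"

lemma grad_eq: "GDERIV f x :> D \<Longrightarrow> grad f x = D"
  for f :: "'a::euclidean_space \<Rightarrow> real"
  unfolding grad_def
proof (rule the_equality)
  fix E assume "GDERIV f x :> D" "GDERIV f x :> E"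
  then have "(\<lambda>h. h \<bullet> D) = (\<lambda>h. h \<bullet> E)"
    unfolding gderiv_def by (rule has_derivative_unique)
  then have "h \<bullet> D = h \<bullet> E" for h by meson
  then show "E = D" by (metis vector_eq_ldot)
qed

subsection \<open>Stationarity notions\<close>

definition vec_min :: "real^'n \<Rightarrow> real^'n \<Rightarrow> real^'n" where
  "vec_min u v = (\<chi> i. min (u $ i) (v $ i))"

definition feasible :: "(real^'n \<Rightarrow> real^'m) \<Rightarrow> real^'n \<Rightarrow> bool" where
  "feasible c x \<longleftrightarrow> c x = 0 \<and> (\<forall>i. x $ i \<ge> 0)"

text \<open>The problem is: minimize \<open>f x\<close> subject to \<open>c x = 0\<close> and \<open>x \<ge> 0\<close>.\<close>

definition eps_KKT_mult ::
  "(real^'n \<Rightarrow> real) \<Rightarrow> (real^'n \<Rightarrow> real^'m) \<Rightarrow> real \<Rightarrow> real^'n \<Rightarrow> real^'m \<Rightarrow> real^'n \<Rightarrow> bool" where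
  "eps_KKT_mult f c \<epsilon> x y z \<longleftrightarrow>
     norm (grad f x + transpose (jacobian c (at x)) *v y + z) \<le> \<epsilon> \<and>
     norm (c x) \<le> \<epsilon> \<and>
     (\<forall>i. x $ i \<ge> - \<epsilon>) \<and>
     (\<forall>i. z $ i \<le> \<epsilon>) \<and>
     (\<forall>i. vec_min x (- z) $ i \<le> \<epsilon>)"

definition KKT_stationary ::
  "(real^'n \<Rightarrow> real) \<Rightarrow> (real^'n \<Rightarrow> real^'m) \<Rightarrow> real^'n \<Rightarrow> bool" where
  "KKT_stationary f c x \<longleftrightarrow> (\<exists>y z. eps_KKT_mult f c 0 x y z)"

definition AKKT_stationary ::
  "(real^'n \<Rightarrow> real) \<Rightarrow> (real^'n \<Rightarrow> real^'m) \<Rightarrow> real^'n \<Rightarrow> bool" where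
  "AKKT_stationary f c x \<longleftrightarrow>
     feasible c x \<and>
     (\<exists>(\<xi> :: nat \<Rightarrow> real^'n) (\<upsilon> :: nat \<Rightarrow> real^'m) (\<zeta> :: nat \<Rightarrow> real^'n).
        \<xi> \<longlonglongrightarrow> x \<and>
        (\<lambda>j. grad f (\<xi> j) + transpose (jacobian c (at (\<xi> j))) *v \<upsilon> j + \<zeta> j) \<longlonglongrightarrow> 0 \<and>
        (\<lambda>j. vec_min (\<xi> j) (- \<zeta> j)) \<longlonglongrightarrow> 0)"

text \<open>
  Purely equality-constrained problem: minimize \<open>F w\<close> subject to \<open>G w = 0\<close>, where \<open>F\<close> may take the
  value \<open>\<infinity>\<close>. The space of \<open>w\<close> need not have the form \<open>real^'k\<close> (below it is a product), so the
  transposed Jacobian is written as the adjoint of the derivative;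
  \<open>adjoint_frechet_derivative_eq\<close> relates the two.
\<close>

definition eq_eps_KKT ::
  "('a::euclidean_space \<Rightarrow> ereal) \<Rightarrow> ('a \<Rightarrow> 'b::euclidean_space) \<Rightarrow> real \<Rightarrow> 'a \<Rightarrow> 'b \<Rightarrow> bool" where
  "eq_eps_KKT F G \<epsilon> w y \<longleftrightarrow>
     \<bar>F w\<bar> \<noteq> \<infinity> \<and>
     norm (grad (\<lambda>v. real_of_ereal (F v)) w + adjoint (frechet_derivative G (at w)) y) \<le> \<epsilon> \<and>
     norm (G w) \<le> \<epsilon>"

lemma adjoint_frechet_derivative_eq:
  fixes c :: "real^'n \<Rightarrow> real^'m"
  assumes "c differentiable (at x)"
  shows "adjoint (frechet_derivative c (at x)) y = transpose (jacobian c (at x)) *v y"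
proof -
  have "frechet_derivative c (at x) = (\<lambda>h. jacobian c (at x) *v h)"
    using assms jacobian_works frechet_derivative_at by metis
  then show ?thesis by (simp add: adjoint_matrix)
qed

subsection \<open>Barrier and regularized subproblem\<close>

definition is_barrier :: "(real \<Rightarrow> ereal) \<Rightarrow> bool" where
  "is_barrier \<beta> \<longleftrightarrow>
     (\<forall>t. \<beta> t \<noteq> - \<infinity>) \<and>
     {t. \<bar>\<beta> t\<bar> \<noteq> \<infinity>} = {0<..} \<and>
     (\<lambda>t. real_of_ereal (\<beta> t)) C1_differentiable_on {0<..} \<and>
     (\<beta> \<longlongrightarrow> \<infinity>) (at_right 0) \<and>
     (\<forall>t>0. deriv (\<lambda>s. real_of_ereal (\<beta> s)) t \<le> 0)"

definition barrier_sum :: "('n \<Rightarrow> real \<Rightarrow> ereal) \<Rightarrow> real^'n \<Rightarrow> ereal" where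
  "barrier_sum b x = (\<Sum>i\<in>UNIV. b i (x $ i))"

definition sub_obj ::
  "(real^'n \<Rightarrow> real) \<Rightarrow> ('n \<Rightarrow> real \<Rightarrow> ereal) \<Rightarrow> real \<Rightarrow> real \<Rightarrow> (real^'n) \<times> (real^'m) \<Rightarrow> ereal" where
  "sub_obj f b \<rho> \<mu> = (\<lambda>(x, l). ereal (f x + \<rho> / 2 * (norm l)\<^sup>2) + ereal \<mu> * barrier_sum b x)"

definition sub_con ::
  "(real^'n \<Rightarrow> real^'m) \<Rightarrow> real \<Rightarrow> real^'m \<Rightarrow> (real^'n) \<times> (real^'m) \<Rightarrow> real^'m" where
  "sub_con c \<rho> yh = (\<lambda>(x, l). c x + \<rho> *\<^sub>R (yh - l))"

subsection \<open>The algorithm\<close>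

record ('m::finite) ip_data =
  eps_init :: real
  rho_init :: real
  mu_init :: real
  kappa_rho :: real
  kappa_mu :: real
  kappa_eps :: real
  theta_rho :: real
  theta_mu :: real
  dual_set :: "(real^'m) set"
  tol :: real

definition valid_data :: "('m::finite) ip_data \<Rightarrow> bool" where
  "valid_data A \<longleftrightarrow>
     eps_init A > 0 \<and> rho_init A > 0 \<and> mu_init A > 0 \<and>
     kappa_rho A \<in> {0<..<1} \<and> kappa_mu A \<in> {0<..<1} \<and> kappa_eps A \<in> {0<..<1} \<and>
     theta_rho A \<in> {0..<1} \<and> theta_mu A \<in> {0..<1} \<and>
     dual_set A \<noteq> {} \<and> bounded (dual_set A) \<and>
     tol A \<ge> 0"

text \<open>
  Well-posedness of the subproblems is understood as solvability to every positive tolerance;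
  the inner tolerances used by the algorithm are all positive.
\<close>

definition subproblems_well_posed ::
  "(real^'n \<Rightarrow> real) \<Rightarrow> (real^'n \<Rightarrow> real^'m) \<Rightarrow> ('n \<Rightarrow> real \<Rightarrow> ereal) \<Rightarrow> 'm ip_data \<Rightarrow> bool" where
  "subproblems_well_posed f c b A \<longleftrightarrow>
     (\<forall>\<rho>\<in>{0<..rho_init A}. \<forall>\<mu>\<in>{0<..mu_init A}. \<forall>yh\<in>dual_set A. \<forall>\<delta>>0.
        \<exists>x l y. eq_eps_KKT (sub_obj f b \<rho> \<mu>) (sub_con c \<rho> yh) \<delta> (x, l) y)"

text \<open>
  An infinite execution, so the stopping test fails in every iteration. The arguments after \<open>A\<close>
  are the sequences \<open>yh\<^sup>k, x\<^sup>k, l\<^sup>k, y\<^sup>k, z\<^sup>k, \<rho>\<^sub>k, \<mu>\<^sub>k, \<epsilon>\<^sub>k\<close>. The index \<open>k - 1\<close> occurs only in a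
  disjunction with \<open>k = 0\<close>.
\<close>

definition ip_run ::
  "(real^'n \<Rightarrow> real) \<Rightarrow> (real^'n \<Rightarrow> real^'m) \<Rightarrow> ('n \<Rightarrow> real \<Rightarrow> ereal) \<Rightarrow> 'm ip_data \<Rightarrow>
   (nat \<Rightarrow> real^'m) \<Rightarrow> (nat \<Rightarrow> real^'n) \<Rightarrow> (nat \<Rightarrow> real^'m) \<Rightarrow> (nat \<Rightarrow> real^'m) \<Rightarrow> (nat \<Rightarrow> real^'n) \<Rightarrow>
   (nat \<Rightarrow> real) \<Rightarrow> (nat \<Rightarrow> real) \<Rightarrow> (nat \<Rightarrow> real) \<Rightarrow> bool" where
  "ip_run f c b A yh x l y z \<rho> \<mu> \<epsilon> \<longleftrightarrow>
     \<rho> 0 = rho_init A \<and> \<mu> 0 = mu_init A \<and> \<epsilon> 0 = eps_init A \<and>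
     (\<forall>k.
        yh k \<in> dual_set A \<and>
        eq_eps_KKT (sub_obj f b (\<rho> k) (\<mu> k)) (sub_con c (\<rho> k) (yh k)) (\<epsilon> k) (x k, l k) (y k) \<and>
        z k = \<mu> k *\<^sub>R grad (\<lambda>v. real_of_ereal (barrier_sum b v)) (x k) \<and>
        \<not> eps_KKT_mult f c (tol A) (x k) (y k) (z k) \<and>
        (let C = (\<lambda>j. norm (c (x j))); V = (\<lambda>j. norm (vec_min (x j) (- z j))) in
          (if k = 0 \<or> C k \<le> max (tol A) (theta_rho A * C (k - 1))
           then \<rho> (Suc k) = \<rho> k
           else \<rho> (Suc k) \<in> {0<..kappa_rho A * \<rho> k}) \<and>
          (if k = 0 \<or> V k \<le> max (tol A) (theta_mu A * V (k - 1))
           then \<mu> (Suc k) = \<mu> k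
           else \<mu> (Suc k) \<in> {0<..kappa_mu A * \<mu> k})) \<and>
        \<epsilon> (Suc k) = max (tol A) (kappa_eps A * \<epsilon> k))"

end

theory Submission
  imports Defs
begin

text \<open>
  The iterates themselves are the witnesses: along the given subsequence, \<open>\<xi> = x\<^sup>k\<close>, \<open>\<upsilon> = y\<^sup>k\<close> and
  \<open>\<zeta> = z\<^sup>k\<close> certify asymptotic stationarity of the limit point.

  The first block of the stationarity condition of the subproblem, the one for \<open>x\<close>, is the
  Lagrangian residual of the original problem, since \<open>\<mu>\<^sub>k \<nabla>b(x\<^sup>k)\<close> is by definition \<open>z\<^sup>k\<close>. So
  \<open>\<nabla>f(x\<^sup>k) + \<nabla>c(x\<^sup>k)\<^sup>T y\<^sup>k + z\<^sup>k\<close> has norm at most \<open>\<epsilon>\<^sub>k\<close> (\<open>ip_run_iterate\<close>), and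
  \<open>\<epsilon>\<^sub>k\<close> decays geometrically. The limit point is feasible by hypothesis.

  What is left is complementarity. Finiteness of the barrier gives \<open>x\<^sup>k > 0\<close>, monotonicity of the
  barrier gives \<open>z\<^sup>k \<le> 0\<close>, so \<open>min {x\<^sup>k, -z\<^sup>k}\<close> is nonnegative and only an upper bound is
  missing (\<open>ip_run_complementarity_tendsto_0\<close>). Either the barrier parameter is reduced finitely
  often, and then the update rule forces the complementarity measure to decay geometrically; or it
  is reduced infinitely often, and then \<open>\<mu>\<^sub>k\<close> tends to 0 (\<open>parameter_or_measure_tendsto_0\<close>). In
  the second case a component with \<open>x\<^sup>*\<^sub>i = 0\<close> is controlled by \<open>x\<^sup>k\<^sub>i\<close>, while for
  \<open>x\<^sup>*\<^sub>i > 0\<close> the barrier derivative stays bounded near \<open>x\<^sup>*\<^sub>i\<close>, so that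
  \<open>z\<^sup>k\<^sub>i = \<mu>\<^sub>k b\<^sub>i'(x\<^sup>k\<^sub>i)\<close> vanishes.

  If the multipliers are bounded, a further subsequence of them converges, and all the conditions
  pass to the limit because the gradient and the Jacobian are continuous
  (\<open>KKT_stationary_limit\<close>).
\<close>

section \<open>Continuity of the gradient and of the transposed Jacobian\<close>

lemma GDERIV_grad:
  fixes f :: "'a::euclidean_space \<Rightarrow> real"
  assumes "f differentiable (at x)"
  shows "GDERIV f x :> grad f x"
proof -
  obtain F where F: "(f has_derivative F) (at x)"
    using assms unfolding differentiable_def by blast
  have "linear F" using F by (rule has_derivative_linear)
  then have "F = (\<lambda>h. h \<bullet> adjoint F 1)"
    by (simp add: fun_eq_iff adjoint_works)
  then have "GDERIV f x :> adjoint F 1"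
    using F unfolding gderiv_def by simp
  then show ?thesis using grad_eq by metis
qed

lemma continuously_differentiable_imp_differentiable:
  "continuously_differentiable f \<Longrightarrow> f differentiable (at x)"
  unfolding continuously_differentiable_def differentiable_def by blast

text \<open>
  Continuous differentiability is expressed by a continuous family of bounded linear maps; evaluated
  at basis vectors, these give the coordinates of the gradient and, in the lemma after this one, the
  columns of the Jacobian.
\<close>

lemma tendsto_grad:
  fixes f :: "'a::euclidean_space \<Rightarrow> real"
  assumes "continuously_differentiable f" and "(u \<longlongrightarrow> a) F"
  shows "((\<lambda>j. grad f (u j)) \<longlongrightarrow> grad f a) F"
proof -
  obtain D where D: "\<And>x. (f has_derivative blinfun_apply (D x)) (at x)"
      and cont: "continuous_on UNIV D"
    using assms(1) unfolding continuously_differentiable_def by blast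
  have "blinfun_apply (D v) = (\<lambda>h. h \<bullet> grad f v)" for v
    using D GDERIV_grad[OF continuously_differentiable_imp_differentiable[OF assms(1)]]
      has_derivative_unique unfolding gderiv_def by blast
  then have eq: "grad f v = (\<Sum>i\<in>Basis. blinfun_apply (D v) i *\<^sub>R i)" for v
    by (simp add: euclidean_representation inner_commute[of _ "grad f v"])
  have "((\<lambda>j. D (u j)) \<longlongrightarrow> D a) F"
    using cont assms(2) by (simp add: continuous_on_tendsto_compose)
  then show ?thesis unfolding eq by (intro tendsto_intros)
qed

lemma tendsto_transpose_jacobian_mult:
  fixes c :: "real^'n \<Rightarrow> real^'m"
  assumes "continuously_differentiable c" and "(u \<longlongrightarrow> a) F" and "(w \<longlongrightarrow> d) F"
  shows "((\<lambda>j. transpose (jacobian c (at (u j))) *v w j)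
    \<longlongrightarrow> transpose (jacobian c (at a)) *v d) F"
proof -
  obtain D where D: "\<And>x. (c has_derivative blinfun_apply (D x)) (at x)"
      and cont: "continuous_on UNIV D"
    using assms(1) unfolding continuously_differentiable_def by blast
  have eq: "transpose (jacobian c (at v)) *v p = (\<chi> i. blinfun_apply (D v) (axis i 1) \<bullet> p)"
    for v p
    using frechet_derivative_at[OF D[of v]]
    by (simp add: vec_eq_iff jacobian_def matrix_def matrix_vector_mult_def transpose_def
        inner_vec_def)
  have "((\<lambda>j. D (u j)) \<longlongrightarrow> D a) F"
    using cont assms(2) by (simp add: continuous_on_tendsto_compose)
  then show ?thesis
    unfolding eq using assms(3) by (intro tendsto_intros)
qed

section \<open>Barrier terms\<close>

lemma barrier_eq_ereal:
  assumes "is_barrier \<beta>" and "t > 0"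
  shows "\<beta> t = ereal (real_of_ereal (\<beta> t))"
proof -
  have "t \<in> {t. \<bar>\<beta> t\<bar> \<noteq> \<infinity>}" using assms unfolding is_barrier_def by simp
  then show ?thesis by (simp add: ereal_real)
qed

lemma barrier_deriv:
  assumes "is_barrier \<beta>"
  defines "\<beta>' \<equiv> deriv (\<lambda>s. real_of_ereal (\<beta> s))"
  shows "t > 0 \<Longrightarrow> ((\<lambda>s. real_of_ereal (\<beta> s)) has_real_derivative \<beta>' t) (at t)"
    and "continuous_on {0<..} \<beta>'"
proof -
  obtain D where D: "\<And>t. t > 0 \<Longrightarrow> ((\<lambda>s. real_of_ereal (\<beta> s)) has_real_derivative D t) (at t)"
      and cont: "continuous_on {0<..} D"
    using assms(1) unfolding is_barrier_def C1_differentiable_on_def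
      has_real_derivative_iff_has_vector_derivative by (metis greaterThan_iff)
  have eq: "\<beta>' t = D t" if "t > 0" for t
    unfolding \<beta>'_def using D[OF that] by (rule DERIV_imp_deriv)
  show "t > 0 \<Longrightarrow> ((\<lambda>s. real_of_ereal (\<beta> s)) has_real_derivative \<beta>' t) (at t)"
    using D eq by simp
  show "continuous_on {0<..} \<beta>'"
    using cont eq by (subst continuous_on_cong[where g = D]) auto
qed

lemma barrier_sum_eq:
  assumes "\<And>i. is_barrier (b i)" and "\<And>i. x $ i > 0"
  shows "barrier_sum b x = ereal (\<Sum>i\<in>UNIV. real_of_ereal (b i (x $ i)))"
  unfolding barrier_sum_def sum_ereal[symmetric]
  using barrier_eq_ereal[OF assms(1) assms(2)] by (intro sum.cong) auto

text \<open>
  Summands equal to \<open>- \<infinity>\<close> are excluded, so nothing can cancel an infinite summand.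
\<close>

lemma barrier_sum_finite_imp_pos:
  assumes "\<And>i. is_barrier (b i)" and "barrier_sum b x \<noteq> \<infinity>"
  shows "x $ i > 0"
proof -
  have "b i (x $ i) \<noteq> \<infinity>"
    using assms(2) unfolding barrier_sum_def by (auto simp: sum_Pinfty)
  moreover have "b i (x $ i) \<noteq> - \<infinity>"
    using assms(1) unfolding is_barrier_def by blast
  ultimately have "x $ i \<in> {t. \<bar>b i t\<bar> \<noteq> \<infinity>}"
    unfolding mem_Collect_eq by (rule ereal_infinity_cases)
  moreover have "{t. \<bar>b i t\<bar> \<noteq> \<infinity>} = {0<..}"
    using assms(1)[of i] unfolding is_barrier_def by (elim conjE)
  ultimately have "x $ i \<in> {0<..}" by (rule back_subst[of "(\<in>) (x $ i)"])
  then show ?thesis by simp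
qed

lemma open_positive_orthant: "open {v :: real^'n. \<forall>i. v $ i > 0}"
proof -
  have "{v :: real^'n. \<forall>i. v $ i > 0} = (\<Inter>i. {v. v $ i > 0})" by auto
  then show ?thesis
    by (auto intro!: open_INT open_Collect_less continuous_intros)
qed

text \<open>
  The extended-valued sum agrees with a sum of real functions only on the positive orthant; since
  that set is open, this is enough for the derivative. The same argument serves \<open>grad_sub_obj\<close>.
\<close>

lemma GDERIV_barrier_sum:
  fixes x :: "real^'n"
  assumes b: "\<And>i. is_barrier (b i)" and x: "\<And>i. x $ i > 0"
  shows "GDERIV (\<lambda>v. real_of_ereal (barrier_sum b v)) x
    :> (\<chi> i. deriv (\<lambda>s. real_of_ereal (b i s)) (x $ i))"
proof -
  have comp: "((\<lambda>v. real_of_ereal (b i (v $ i))) has_derivative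
      (\<lambda>h. h $ i * deriv (\<lambda>s. real_of_ereal (b i s)) (x $ i))) (at x)" for i
    by (rule DERIV_compose_FDERIV[OF barrier_deriv(1)[OF b x]
          bounded_linear_imp_has_derivative[OF bounded_linear_vec_nth]])
  have "((\<lambda>v. \<Sum>i\<in>UNIV. real_of_ereal (b i (v $ i))) has_derivative
      (\<lambda>h. h \<bullet> (\<chi> i. deriv (\<lambda>s. real_of_ereal (b i s)) (x $ i)))) (at x)"
    by (rule has_derivative_eq_rhs[OF has_derivative_sum[OF comp]]) (simp add: inner_vec_def)
  then show ?thesis
    unfolding gderiv_def
    by (rule has_derivative_transform_within_open[OF _ open_positive_orthant])
      (use b x in \<open>auto simp: barrier_sum_eq\<close>)
qed

lemmas grad_barrier_sum = grad_eq[OF GDERIV_barrier_sum]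

section \<open>Stationarity of the subproblem\<close>

lemma grad_sub_obj:
  fixes x :: "real^'n" and l :: "real^'m"
  assumes f: "f differentiable (at x)" and b: "\<And>i. is_barrier (b i)" and x: "\<And>i. x $ i > 0"
  shows "grad (\<lambda>v. real_of_ereal (sub_obj f b \<rho> \<mu> v)) (x, l) =
    (grad f x + \<mu> *\<^sub>R grad (\<lambda>v. real_of_ereal (barrier_sum b v)) x, \<rho> *\<^sub>R l)"
proof (rule grad_eq, unfold gderiv_def, rule has_derivative_transform_within_open)
  let ?B = "\<lambda>v. real_of_ereal (barrier_sum b v)"
  let ?w = "(x, l)"
  have Df: "(f has_derivative (\<lambda>h. h \<bullet> grad f x)) (at (fst ?w))"
    using GDERIV_grad[OF f] by (simp add: gderiv_def)
  have DB: "(?B has_derivative (\<lambda>h. h \<bullet> grad ?B x)) (at (fst ?w))"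
    using GDERIV_barrier_sum[OF b x] grad_barrier_sum[OF b x] by (simp add: gderiv_def)
  have fst: "(fst has_derivative fst) (at ?w)" and snd: "(snd has_derivative snd) (at ?w)"
    by (auto intro!: derivative_eq_intros)
  show "((\<lambda>w. f (fst w) + \<rho> / 2 * (snd w \<bullet> snd w) + \<mu> * ?B (fst w)) has_derivative
      (\<lambda>h. h \<bullet> (grad f x + \<mu> *\<^sub>R grad ?B x, \<rho> *\<^sub>R l))) (at ?w)"
    by (rule has_derivative_eq_rhs, (rule derivative_intros has_derivative_compose[OF fst Df]
          has_derivative_compose[OF fst DB] snd)+)
      (auto simp: fun_eq_iff inner_prod_def inner_add_right inner_commute)
  show "open ({v :: real^'n. \<forall>i. v $ i > 0} \<times> (UNIV :: (real^'m) set))"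
    by (intro open_Times open_positive_orthant open_UNIV)
  show "?w \<in> {v. \<forall>i. v $ i > 0} \<times> UNIV" using x by simp
  show "f (fst w) + \<rho> / 2 * (snd w \<bullet> snd w) + \<mu> * ?B (fst w) = real_of_ereal (sub_obj f b \<rho> \<mu> w)"
    if "w \<in> {v. \<forall>i. v $ i > 0} \<times> UNIV" for w
    using that b by (auto simp: sub_obj_def barrier_sum_eq power2_norm_eq_inner split: prod.splits)
qed

lemma adjoint_sub_con:
  fixes x :: "real^'n" and c :: "real^'n \<Rightarrow> real^'m"
  assumes "c differentiable (at x)"
  shows "adjoint (frechet_derivative (sub_con c \<rho> yh) (at (x, l))) p =
    (transpose (jacobian c (at x)) *v p, - \<rho> *\<^sub>R p)"
proof -
  let ?w = "(x, l)" and ?J = "frechet_derivative c (at x)"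
  have Dc: "(c has_derivative ?J) (at (fst ?w))"
    using assms by (simp add: frechet_derivative_works)
  have fst: "(fst has_derivative fst) (at ?w)" and snd: "(snd has_derivative snd) (at ?w)"
    by (auto intro!: derivative_eq_intros)
  have eq: "sub_con c \<rho> yh = (\<lambda>w. c (fst w) + \<rho> *\<^sub>R (yh - snd w))"
    by (auto simp: sub_con_def)
  have "(sub_con c \<rho> yh has_derivative (\<lambda>h. ?J (fst h) - \<rho> *\<^sub>R snd h)) (at ?w)"
    unfolding eq
    by (rule has_derivative_eq_rhs, (rule derivative_intros has_derivative_compose[OF fst Dc]
          snd)+) auto
  then have D: "frechet_derivative (sub_con c \<rho> yh) (at ?w) = (\<lambda>h. ?J (fst h) - \<rho> *\<^sub>R snd h)"
    by (rule frechet_derivative_at[symmetric])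
  have "linear ?J" using Dc by (rule has_derivative_linear)
  then have "adjoint (\<lambda>h. ?J (fst h) - \<rho> *\<^sub>R snd h) = (\<lambda>p. (adjoint ?J p, - \<rho> *\<^sub>R p))"
    by (intro adjoint_unique)
      (auto simp: inner_prod_def inner_diff_left adjoint_works)
  then show ?thesis
    using D adjoint_frechet_derivative_eq[OF assms] by simp
qed

text \<open>
  The gradient of the Lagrangian of the subproblem is a pair, and its norm dominates that of its
  first component, the derivative in \<open>x\<close>; the component in \<open>l\<close> is \<open>\<rho> (l - y)\<close>.
\<close>

lemma subproblem_KKT_imp:
  fixes x :: "real^'n" and c :: "real^'n \<Rightarrow> real^'m"
  assumes f: "f differentiable (at x)" and c: "c differentiable (at x)"
    and b: "\<And>i. is_barrier (b i)" and \<mu>: "\<mu> > 0"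
    and KKT: "eq_eps_KKT (sub_obj f b \<rho> \<mu>) (sub_con c \<rho> yh) \<delta> (x, l) y"
  shows "x $ i > 0"
    and "norm (grad f x + transpose (jacobian c (at x)) *v y
      + \<mu> *\<^sub>R grad (\<lambda>v. real_of_ereal (barrier_sum b v)) x) \<le> \<delta>"
proof -
  have "barrier_sum b x \<noteq> \<infinity>"
    using KKT \<mu> unfolding eq_eps_KKT_def sub_obj_def by auto
  then show pos: "x $ i > 0" for i
    by (rule barrier_sum_finite_imp_pos[OF b])
  have "norm (grad (\<lambda>v. real_of_ereal (sub_obj f b \<rho> \<mu> v)) (x, l)
      + adjoint (frechet_derivative (sub_con c \<rho> yh) (at (x, l))) y) \<le> \<delta>"
    using KKT unfolding eq_eps_KKT_def by blast
  then have "norm (grad f x + \<mu> *\<^sub>R grad (\<lambda>v. real_of_ereal (barrier_sum b v)) x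
      + transpose (jacobian c (at x)) *v y) \<le> \<delta>"
    unfolding grad_sub_obj[OF f b pos] adjoint_sub_con[OF c]
    by (simp only: add_Pair) (rule order_trans[OF norm_fst_le])
  then show "norm (grad f x + transpose (jacobian c (at x)) *v y
      + \<mu> *\<^sub>R grad (\<lambda>v. real_of_ereal (barrier_sum b v)) x) \<le> \<delta>"
    by (simp add: algebra_simps)
qed

section \<open>Parameter updates\<close>

lemma geometric_decay_tendsto_0:
  fixes a :: "nat \<Rightarrow> real"
  assumes "\<And>k. a k \<ge> 0" and q: "0 \<le> q" "q < 1"
    and "\<forall>\<^sub>F k in sequentially. a (Suc k) \<le> q * a k"
  shows "a \<longlonglongrightarrow> 0"
proof -
  obtain N where N: "\<And>k. k \<ge> N \<Longrightarrow> a (Suc k) \<le> q * a k"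
    using assms(4) by (auto simp: eventually_sequentially)
  have le: "a (j + N) \<le> q ^ j * a N" for j
  proof (induction j)
    case (Suc j)
    have "a (Suc j + N) \<le> q * a (j + N)" using N[of "j + N"] by simp
    also have "\<dots> \<le> q * (q ^ j * a N)" using Suc q by (intro mult_left_mono) auto
    finally show ?case by (simp add: mult_ac)
  qed simp
  have "(\<lambda>j. q ^ j * a N) \<longlonglongrightarrow> 0"
    using q by (intro tendsto_mult_left_zero LIMSEQ_realpow_zero)
  then have "(\<lambda>j. a (j + N)) \<longlonglongrightarrow> 0"
    by (rule tendsto_sandwich[OF _ _ tendsto_const, rotated 2])
      (use assms(1) le in auto)
  then show ?thesis by (rule LIMSEQ_offset)
qed

text \<open>
  This is the dichotomy behind the update rules, with \<open>p\<close> a penalty or barrier parameter and \<open>V\<close>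
  the violation that it is meant to reduce. The hypotheses start at index 1 because the first
  iteration of the algorithm never changes the parameters.
\<close>

lemma parameter_or_measure_tendsto_0:
  fixes p V :: "nat \<Rightarrow> real"
  assumes p: "\<And>k. p k > 0" and V: "\<And>k. V k \<ge> 0"
    and \<kappa>: "0 < \<kappa>" "\<kappa> < 1" and \<theta>: "0 \<le> \<theta>" "\<theta> < 1"
    and keep: "\<And>k. V (Suc k) \<le> \<theta> * V k \<Longrightarrow> p (Suc (Suc k)) = p (Suc k)"
    and reduce: "\<And>k. \<not> V (Suc k) \<le> \<theta> * V k \<Longrightarrow> p (Suc (Suc k)) \<le> \<kappa> * p (Suc k)"
  shows "p \<longlonglongrightarrow> 0 \<or> V \<longlonglongrightarrow> 0"
proof (cases "\<forall>\<^sub>F k in sequentially. V (Suc k) \<le> \<theta> * V k")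
  case True
  then have "V \<longlonglongrightarrow> 0" using V \<theta> by (intro geometric_decay_tendsto_0)
  then show ?thesis ..
next
  case False
  have "\<kappa> * p k \<le> p k" for k using p[of k] \<kappa> by simp
  then have "decseq (\<lambda>k. p (Suc k))"
    using keep reduce by (intro decseq_SucI) (metis order_refl order_trans)
  then obtain L where L: "(\<lambda>k. p (Suc k)) \<longlonglongrightarrow> L" and ge: "\<And>k. L \<le> p (Suc k)"
    using p by (metis decseq_convergent less_imp_le)
  \<comment> \<open>A positive limit is impossible: once \<open>p\<close> is below \<open>L / \<kappa>\<close>, one more reduction would push it
    below \<open>L\<close>, so no further reduction occurs.\<close>
  have "L = 0"
  proof (rule ccontr)
    assume "L \<noteq> 0"
    moreover have "L \<ge> 0" using L p by (intro LIMSEQ_le_const) (auto intro: less_imp_le)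
    ultimately have "L < L / \<kappa>" using \<kappa> by (simp add: field_simps)
    then have "\<forall>\<^sub>F k in sequentially. p (Suc k) < L / \<kappa>"
      by (rule order_tendstoD(2)[OF L])
    moreover have "V (Suc k) \<le> \<theta> * V k" if "p (Suc k) < L / \<kappa>" for k
    proof (rule ccontr)
      assume "\<not> V (Suc k) \<le> \<theta> * V k"
      then have "p (Suc (Suc k)) \<le> \<kappa> * p (Suc k)" by (rule reduce)
      also have "\<dots> < L" using that \<kappa> by (simp add: field_simps)
      finally show False using ge[of "Suc k"] by simp
    qed
    ultimately show False using False by (simp add: eventually_mono)
  qed
  then show ?thesis using L by (simp add: filterlim_sequentially_Suc)
qed

section \<open>Iterates of the algorithm\<close>

lemma ip_run_tolerance_tendsto_0:
  assumes "valid_data A" and "tol A = 0" and "ip_run f c b A yh x l y z \<rho> \<mu> \<epsilon>"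
  shows "\<epsilon> \<longlonglongrightarrow> 0"
proof -
  have \<kappa>: "0 < kappa_eps A" "kappa_eps A < 1" and "\<epsilon> 0 > 0"
    and step: "\<epsilon> (Suc k) = max 0 (kappa_eps A * \<epsilon> k)" for k
    using assms unfolding ip_run_def valid_data_def by auto
  have nonneg: "\<epsilon> k \<ge> 0" for k
    using \<open>\<epsilon> 0 > 0\<close> step by (cases k) auto
  then show ?thesis
    using \<kappa> step by (intro geometric_decay_tendsto_0[of _ "kappa_eps A"]) auto
qed

lemma ip_run_barrier_parameter_pos:
  assumes "valid_data A" and "ip_run f c b A yh x l y z \<rho> \<mu> \<epsilon>"
  shows "\<mu> k > 0"
proof (induction k)
  case 0
  then show ?case using assms unfolding ip_run_def valid_data_def by simp
next
  case (Suc k)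
  have "\<mu> (Suc k) = \<mu> k \<or> \<mu> (Suc k) > 0"
    using assms(2) unfolding ip_run_def Let_def by (metis greaterThanAtMost_iff)
  then show ?case using Suc by auto
qed

lemma ip_run_barrier_parameter_or_complementarity:
  assumes "valid_data A" and "tol A = 0" and "ip_run f c b A yh x l y z \<rho> \<mu> \<epsilon>"
  shows "\<mu> \<longlonglongrightarrow> 0 \<or> (\<lambda>k. vec_min (x k) (- z k)) \<longlonglongrightarrow> 0"
proof -
  let ?V = "\<lambda>k. norm (vec_min (x k) (- z k))"
  have par: "0 < kappa_mu A" "kappa_mu A < 1" "0 \<le> theta_mu A" "theta_mu A < 1"
    using assms(1) unfolding valid_data_def by auto
  have upd: "if ?V (Suc k) \<le> theta_mu A * ?V k then \<mu> (Suc (Suc k)) = \<mu> (Suc k)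
      else \<mu> (Suc (Suc k)) \<in> {0<..kappa_mu A * \<mu> (Suc k)}" for k
  proof -
    have "if Suc k = 0 \<or> ?V (Suc k) \<le> max (tol A) (theta_mu A * ?V (Suc k - 1))
      then \<mu> (Suc (Suc k)) = \<mu> (Suc k)
      else \<mu> (Suc (Suc k)) \<in> {0<..kappa_mu A * \<mu> (Suc k)}"
      using assms(3) unfolding ip_run_def Let_def by blast
    moreover have "max (tol A) (theta_mu A * ?V (Suc k - 1)) = theta_mu A * ?V k"
      using assms(2) par by simp
    ultimately show ?thesis by simp
  qed
  have "\<mu> \<longlonglongrightarrow> 0 \<or> ?V \<longlonglongrightarrow> 0"
    by (rule parameter_or_measure_tendsto_0[OF ip_run_barrier_parameter_pos[OF assms(1,3)]
          norm_ge_zero par]) (metis upd greaterThanAtMost_iff)+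
  then show ?thesis by (simp add: tendsto_norm_zero_iff)
qed

lemma ip_run_iterate:
  fixes c :: "real^'n \<Rightarrow> real^'m"
  assumes "continuously_differentiable f" and "continuously_differentiable c"
    and b: "\<And>i. is_barrier (b i)"
    and "valid_data A" and run: "ip_run f c b A yh x l y z \<rho> \<mu> \<epsilon>"
  shows "x k $ i > 0"
    and "z k $ i = \<mu> k * deriv (\<lambda>s. real_of_ereal (b i s)) (x k $ i)"
    and "z k $ i \<le> 0"
    and "norm (grad f (x k) + transpose (jacobian c (at (x k))) *v y k + z k) \<le> \<epsilon> k"
proof -
  note diff = assms(1,2)[THEN continuously_differentiable_imp_differentiable]
  have \<mu>: "\<mu> k > 0" using assms(4) run by (rule ip_run_barrier_parameter_pos)
  have KKT: "eq_eps_KKT (sub_obj f b (\<rho> k) (\<mu> k)) (sub_con c (\<rho> k) (yh k)) (\<epsilon> k) (x k, l k) (y k)"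
    and z: "z k = \<mu> k *\<^sub>R grad (\<lambda>v. real_of_ereal (barrier_sum b v)) (x k)"
    using run unfolding ip_run_def by blast+
  note sub = subproblem_KKT_imp[OF diff b \<mu> KKT]
  show "x k $ i > 0" by (rule sub(1))
  show "norm (grad f (x k) + transpose (jacobian c (at (x k))) *v y k + z k) \<le> \<epsilon> k"
    unfolding z by (rule sub(2))
  show zi: "z k $ i = \<mu> k * deriv (\<lambda>s. real_of_ereal (b i s)) (x k $ i)"
    unfolding z by (simp add: grad_barrier_sum[OF b sub(1)])
  have "deriv (\<lambda>s. real_of_ereal (b i s)) (x k $ i) \<le> 0"
    using b[of i] sub(1) unfolding is_barrier_def by blast
  then show "z k $ i \<le> 0" using \<mu> by (simp add: zi mult_nonneg_nonpos)
qed

text \<open>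
  When \<open>\<mu>\<close> vanishes, each component needs only one of the two entries of the minimum to be small:
  \<open>x\<close> where the limit is on the boundary, \<open>z\<close> where it is in the interior. The multipliers
  \<open>z\<close> may be unbounded in components of the first kind.
\<close>

lemma ip_run_complementarity_tendsto_0:
  fixes c :: "real^'n \<Rightarrow> real^'m"
  assumes "continuously_differentiable f" and "continuously_differentiable c"
    and b: "\<And>i. is_barrier (b i)"
    and "valid_data A" and "tol A = 0" and run: "ip_run f c b A yh x l y z \<rho> \<mu> \<epsilon>"
    and s: "strict_mono s" and lim: "(\<lambda>j. x (s j)) \<longlonglongrightarrow> xstar"
    and nonneg: "\<And>i. xstar $ i \<ge> 0"
  shows "(\<lambda>j. vec_min (x (s j)) (- z (s j))) \<longlonglongrightarrow> 0"
  using ip_run_barrier_parameter_or_complementarity[OF assms(4-6)]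
proof
  note iterate = ip_run_iterate[OF assms(1-4) run]
  assume \<mu>: "\<mu> \<longlonglongrightarrow> 0"
  have "(\<lambda>j. min (x (s j) $ i) (- z (s j) $ i)) \<longlonglongrightarrow> 0" for i
  proof -
    have xi: "(\<lambda>j. x (s j) $ i) \<longlonglongrightarrow> xstar $ i" using lim by (rule tendsto_vec_nth)
    have lower: "0 \<le> min (x (s j) $ i) (- z (s j) $ i)" for j
      using iterate(1)[of "s j" i] iterate(3)[of "s j" i] by simp
    show ?thesis
    proof (cases "xstar $ i = 0")
      case True
      then show ?thesis
        by (intro tendsto_sandwich[OF _ _ tendsto_const xi[unfolded True]])
          (use lower in auto)
    next
      case False
      let ?d = "deriv (\<lambda>s. real_of_ereal (b i s))"
      have "xstar $ i > 0" using False nonneg[of i] by simp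
      then have "isCont ?d (xstar $ i)"
        using barrier_deriv(2)[OF b] by (simp add: continuous_on_eq_continuous_at)
      then have "(\<lambda>j. ?d (x (s j) $ i)) \<longlonglongrightarrow> ?d (xstar $ i)"
        using xi by (rule isCont_tendsto_compose)
      then have "(\<lambda>j. \<mu> (s j) * ?d (x (s j) $ i)) \<longlonglongrightarrow> 0 * ?d (xstar $ i)"
        by (intro tendsto_mult LIMSEQ_subseq_LIMSEQ[OF \<mu> s, unfolded o_def])
      then have "(\<lambda>j. - z (s j) $ i) \<longlonglongrightarrow> 0"
        using tendsto_minus by (fastforce simp: iterate(2))
      then show ?thesis
        by (rule tendsto_sandwich[OF _ _ tendsto_const, rotated 2]) (use lower in auto)
    qed
  qed
  then show ?thesis by (intro vec_tendstoI) (simp add: vec_min_def)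
next
  assume "(\<lambda>k. vec_min (x k) (- z k)) \<longlonglongrightarrow> 0"
  then show ?thesis using LIMSEQ_subseq_LIMSEQ[OF _ s] by (fastforce simp: o_def)
qed

section \<open>Limit points\<close>

text \<open>
  An asymptotically stationary sequence whose multipliers are bounded is stationary in the limit:
  compactness supplies limit multipliers, and every condition is closed.
\<close>

lemma KKT_stationary_limit:
  fixes f :: "real^'n \<Rightarrow> real" and c :: "real^'n \<Rightarrow> real^'m"
  assumes "continuously_differentiable f" and "continuously_differentiable c"
    and feas: "feasible c a"
    and u: "u \<longlonglongrightarrow> a" and bdd: "bounded (range (\<lambda>j. (p j, q j)))"
    and sign: "\<And>i j. q j $ i \<le> 0"
    and res: "(\<lambda>j. grad f (u j) + transpose (jacobian c (at (u j))) *v p j + q j) \<longlonglongrightarrow> 0"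
    and compl: "(\<lambda>j. vec_min (u j) (- q j)) \<longlonglongrightarrow> 0"
  shows "KKT_stationary f c a"
proof -
  obtain w r where r: "strict_mono (r :: nat \<Rightarrow> nat)"
      and w: "((\<lambda>j. (p j, q j)) \<circ> r) \<longlonglongrightarrow> w"
    using bounded_imp_convergent_subsequence[OF bdd] by blast
  define pstar qstar where "pstar = fst w" and "qstar = snd w"
  have p: "(\<lambda>j. p (r j)) \<longlonglongrightarrow> pstar" and q: "(\<lambda>j. q (r j)) \<longlonglongrightarrow> qstar"
    using tendsto_fst[OF w] tendsto_snd[OF w] by (simp_all add: o_def pstar_def qstar_def)
  note sub = LIMSEQ_subseq_LIMSEQ[OF _ r, unfolded o_def]
  have ur: "(\<lambda>j. u (r j)) \<longlonglongrightarrow> a" using u by (rule sub)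
  have "(\<lambda>j. grad f (u (r j)) + transpose (jacobian c (at (u (r j)))) *v p (r j) + q (r j))
      \<longlonglongrightarrow> grad f a + transpose (jacobian c (at a)) *v pstar + qstar"
    by (intro tendsto_add tendsto_grad tendsto_transpose_jacobian_mult assms(1,2) ur p q)
  then have stat: "grad f a + transpose (jacobian c (at a)) *v pstar + qstar = 0"
    using sub[OF res] by (rule LIMSEQ_unique)
  have "qstar $ i \<le> 0" for i
    using sign by (intro LIMSEQ_le_const2[OF tendsto_vec_nth[OF q]]) auto
  moreover have "vec_min a (- qstar) $ i = 0" for i
  proof -
    have "(\<lambda>j. min (u (r j) $ i) (- q (r j) $ i)) \<longlonglongrightarrow> min (a $ i) (- qstar $ i)"
      by (intro tendsto_min tendsto_vec_nth tendsto_minus ur q)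
    moreover have "(\<lambda>j. min (u (r j) $ i) (- q (r j) $ i)) \<longlonglongrightarrow> 0"
      using tendsto_vec_nth[OF sub[OF compl], of i] by (simp add: vec_min_def)
    ultimately show ?thesis by (simp add: vec_min_def LIMSEQ_unique)
  qed
  ultimately have "eps_KKT_mult f c 0 a pstar qstar"
    using stat feas unfolding eps_KKT_mult_def feasible_def by simp
  then show ?thesis unfolding KKT_stationary_def by blast
qed

theorem theorem4p5:
  fixes f :: "real^'n \<Rightarrow> real" and c :: "real^'n \<Rightarrow> real^'m"
    and b :: "'n \<Rightarrow> real \<Rightarrow> ereal" and A :: "'m ip_data"
    and yh l y :: "nat \<Rightarrow> real^'m" and x z :: "nat \<Rightarrow> real^'n"
    and \<rho> \<mu> \<epsilon> :: "nat \<Rightarrow> real"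
    and xstar :: "real^'n" and K :: "nat set"
  assumes "continuously_differentiable f" and "continuously_differentiable c"
    and "\<And>i. is_barrier (b i)"
    and "valid_data A" and "tol A = 0"
    and "subproblems_well_posed f c b A"
    and "ip_run f c b A yh x l y z \<rho> \<mu> \<epsilon>"
    and "infinite K" and "(\<lambda>j. x (enumerate K j)) \<longlonglongrightarrow> xstar"
    and "feasible c xstar"
  shows "AKKT_stationary f c xstar \<and>
    (bounded ((\<lambda>k. (y k, z k)) ` K) \<longrightarrow> KKT_stationary f c xstar)"
proof (intro conjI impI)
  let ?s = "enumerate K"
  have s: "strict_mono ?s" using assms(8) by (rule strict_mono_enumerate)
  have nonneg: "xstar $ i \<ge> 0" for i using assms(10) unfolding feasible_def by blast
  note iterate = ip_run_iterate[OF assms(1-4,7)]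
  have compl: "(\<lambda>j. vec_min (x (?s j)) (- z (?s j))) \<longlonglongrightarrow> 0"
    by (rule ip_run_complementarity_tendsto_0[OF assms(1-5,7) s assms(9) nonneg])
  have "(\<lambda>k. grad f (x k) + transpose (jacobian c (at (x k))) *v y k + z k) \<longlonglongrightarrow> 0"
    using ip_run_tolerance_tendsto_0[OF assms(4,5,7)]
    by (rule Lim_null_comparison[OF always_eventually, rotated]) (use iterate(4) in blast)
  then have res: "(\<lambda>j. grad f (x (?s j)) + transpose (jacobian c (at (x (?s j)))) *v y (?s j)
      + z (?s j)) \<longlonglongrightarrow> 0"
    using LIMSEQ_subseq_LIMSEQ[OF _ s] by (fastforce simp: o_def)
  show "AKKT_stationary f c xstar"
    unfolding AKKT_stationary_def using assms(9,10) res compl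
    by (intro conjI exI[of _ "\<lambda>j. x (?s j)"] exI[of _ "\<lambda>j. y (?s j)"] exI[of _ "\<lambda>j. z (?s j)"])
  assume "bounded ((\<lambda>k. (y k, z k)) ` K)"
  then have "bounded (range (\<lambda>j. (y (?s j), z (?s j))))"
    by (rule bounded_subset) (auto intro: enumerate_in_set[OF assms(8)])
  then show "KKT_stationary f c xstar"
    by (rule KKT_stationary_limit[OF assms(1,2,10,9)]) (use iterate(3) res compl in auto)
qed

end
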